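(* Let $(a_n)_{n\ge 1}$ be a sequence of positive real numbers which is good and which is $(r,s)$-monotone for some constants $r,s\ge 1$. Suppose that for some $\epsilon>0$ we have $a_n\ge(\log n)^{1/2+\epsilon}$ for all sufficiently large $n$. Let $\xi_1,\xi_2,\dots$ be i.i.d. two-dimensional Rademacher random variables. Then the two-dimensional Rademacher walk $S_n=\sum_{i=1}^n a_i\xi_i$ is transient.
   Context: Let $\mathbf{e}_1=(1,0)$, $\mathbf{e}_2=(0,1)$. A random vector $\xi$ has the two-dimensional Rademacher distribution if it takes each of the values $\mathbf{e}_1,\mathbf{e}_2,-\mathbf{e}_1,-\mathbf{e}_2$ with probability $1/4$. For a deterministic sequence $(a_n)$ of positive real numbers (not necessarily integers) and i.i.d. two-dimensional Rademacher variables $\xi_1,\xi_2,\dots$, the two-dimensional Rademacher walk is $S_n=\sum_{i=1}^n a_i\xi_i$. The walk is called transient if $\|S_n\|\to\infty$ almost surely. A sequence $(a_n)$ of positive reals is called good if for each sufficiently large $n$ there is a positive integer $K_n$ such that $\frac{K_n}{\log_2 a_n}\to 1$ as $n\to\infty$, and there is a subset of $\{1,2,\dots,n\}$ with $K_n$ distinct elements $i_1,i_2,\dots,i_{K_n}$ such that $i_{K_n}=n$ and $a_{i_{k+1}}\ge 2a_{i_k}$ for every $k=1,2,\dots,K_n-1$. For constants $r,s\ge 1$, a sequence $(a_n)$ is called $(r,s)$-monotone if for all sufficiently large $n$ we have $a_n\le s\,a_m$ whenever $m\ge rn$. *)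

theory Defs
  imports "HOL-Probability.Probability"
begin

text \<open>
  Sequences and walks are indexed from 1: a sequence \<open>a\<close> of type \<open>nat \<Rightarrow> real\<close> represents
  \<open>a 1, a 2, \<dots>\<close>, and the value \<open>a 0\<close> is never used.  The plane is \<open>real \<times> real\<close>, whose
  library norm is the Euclidean one.
\<close>

definition rademacher2 :: "'w measure \<Rightarrow> ('w \<Rightarrow> real \<times> real) \<Rightarrow> bool" where
  "rademacher2 M X \<longleftrightarrow>
     X \<in> borel_measurable M \<and>
     (\<forall>v \<in> {(1, 0), (0, 1), - (1, 0), - (0, 1)}.
        measure M {\<omega> \<in> space M. X \<omega> = v} = 1 / 4)"

definition iid_rademacher2 :: "'w measure \<Rightarrow> (nat \<Rightarrow> 'w \<Rightarrow> real \<times> real) \<Rightarrow> bool" where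
  "iid_rademacher2 M \<xi> \<longleftrightarrow>
     prob_space.indep_vars M (\<lambda>_. borel) \<xi> {1..} \<and> (\<forall>i\<ge>1. rademacher2 M (\<xi> i))"

definition walk2 :: "(nat \<Rightarrow> real) \<Rightarrow> (nat \<Rightarrow> 'w \<Rightarrow> real \<times> real) \<Rightarrow> nat \<Rightarrow> 'w \<Rightarrow> real \<times> real" where
  "walk2 a \<xi> n \<omega> = (\<Sum>i = 1..n. a i *\<^sub>R \<xi> i \<omega>)"

definition transient_walk :: "'w measure \<Rightarrow> (nat \<Rightarrow> 'w \<Rightarrow> real \<times> real) \<Rightarrow> bool" where
  "transient_walk M S \<longleftrightarrow> (AE \<omega> in M. filterlim (\<lambda>n. norm (S n \<omega>)) at_top sequentially)"

text \<open>
  \<open>doubling_chain a n K i\<close>: the distinct indices \<open>i 1, \<dots>, i K\<close> lie in \<open>{1..n}\<close>, end in \<open>n\<close>, and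
  \<open>a\<close> at least doubles along them.  The indices need not be increasing.
\<close>

definition doubling_chain :: "(nat \<Rightarrow> real) \<Rightarrow> nat \<Rightarrow> nat \<Rightarrow> (nat \<Rightarrow> nat) \<Rightarrow> bool" where
  "doubling_chain a n K i \<longleftrightarrow>
     i ` {1..K} \<subseteq> {1..n} \<and> inj_on i {1..K} \<and> i K = n \<and>
     (\<forall>k. 1 \<le> k \<and> k < K \<longrightarrow> a (i (Suc k)) \<ge> 2 * a (i k))"

text \<open>
  \<open>K\<close> is a total function, but only its values at all sufficiently large \<open>n\<close> matter.
\<close>

definition good_seq :: "(nat \<Rightarrow> real) \<Rightarrow> bool" where
  "good_seq a \<longleftrightarrow>
     (\<exists>K :: nat \<Rightarrow> nat.
        (\<forall>\<^sub>F n in sequentially. K n > 0 \<and> (\<exists>i. doubling_chain a n (K n) i)) \<and>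
        (\<lambda>n. real (K n) / log 2 (a n)) \<longlonglongrightarrow> 1)"

definition rs_monotone :: "real \<Rightarrow> real \<Rightarrow> (nat \<Rightarrow> real) \<Rightarrow> bool" where
  "rs_monotone r s a \<longleftrightarrow>
     (\<forall>\<^sub>F n in sequentially. \<forall>m. real m \<ge> r * real n \<longrightarrow> a n \<le> s * a m)"

end

theory Submission
  imports Defs "HOL-Real_Asymp.Real_Asymp"
begin

text \<open>
  In the coordinates \<open>(x + y, x - y)\<close> the walk becomes a pair of independent one-dimensional sign
  sums \<open>\<Sum> \<plusminus> a i\<close>, so the probability of \<open>norm (S n) \<le> R\<close> is at most the square of the probability
  that such a sum lies in an interval of length \<open>O(R)\<close>.  Put \<open>m = \<lfloor>n / (2 r)\<rfloor>\<close>.  The \<open>2 ^ K\<close> signed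
  sums over a doubling chain ending in \<open>m\<close> are separated and of size at most \<open>2 a m\<close>; hence
  the chain contributes a factor \<open>2 ^ (- K) = a m ^ (- 1 + o(1))\<close>, provided that the sum of the
  remaining terms lands in an interval of length \<open>O(a m)\<close>.  By monotonicity at least \<open>n / 2\<close> of
  those are bounded below by \<open>a m / s\<close>, so by the Littlewood--Offord inequality the latter
  has probability \<open>O(1 / sqrt n)\<close>.  Squaring and the growth
  hypothesis give \<open>O(1 / (n (ln n) powr (1 + \<epsilon>)))\<close>, which is summable, and Borel--Cantelli applies.
\<close>

section \<open>Antichains of finite sets\<close>

text \<open>
  The induction applies the hypothesis to \<open>{X \<in> F. x \<notin> X}\<close>, an antichain in \<open>A - {x}\<close>, and sums
  over \<open>x \<in> A\<close>.
\<close>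

lemma lym_inequality:
  assumes "finite A" "F \<subseteq> Pow A" "\<And>X Y. X \<in> F \<Longrightarrow> Y \<in> F \<Longrightarrow> X \<subseteq> Y \<Longrightarrow> X = Y"
  shows "(\<Sum>X\<in>F. 1 / real (card A choose card X)) \<le> 1"
  using assms
proof (induction "card A" arbitrary: A F)
  case 0
  then have "F \<subseteq> {{}}" by auto
  then have "F = {} \<or> F = {{}}" by blast
  then show ?case using 0 by auto
next
  case (Suc n)
  have finF: "finite F" using Suc.prems by (meson finite_Pow_iff finite_subset)
  show ?case
  proof (cases "A \<in> F")
    case True
    then have "F = {A}" using Suc.prems by (metis PowD insertI1 insert_absorb subsetD subsetI
      subset_antisym subset_singletonD singletonI singleton_insert_inj_eq')
    then show ?thesis by simp
  next
    case False
    have IH: "(\<Sum>X\<in>{X\<in>F. x \<notin> X}. 1 / real (n choose card X)) \<le> 1" if "x \<in> A" for x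
    proof -
      have c: "n = card (A - {x})" using Suc.hyps(2) that Suc.prems(1) by simp
      have "(\<Sum>X\<in>{X\<in>F. x \<notin> X}. 1 / real (card (A - {x}) choose card X)) \<le> 1"
        by (rule Suc.hyps(1)[OF c]) (use Suc.prems in auto)
      then show ?thesis using c by simp
    qed
    \<comment> \<open>A set \<open>X\<close> is counted once for each \<open>x \<in> A - X\<close>;
      absorption turns this multiplicity into the weight for the larger ground set. Since
      \<open>A \<notin> F\<close>, every \<open>X\<close> is proper, so
      \<open>n choose card X\<close> is nonzero.\<close>
    have w: "real (card (A - X)) / real (n choose card X) = real (Suc n) / real (Suc n choose card X)"
      if "X \<in> F" for X
    proof -
      have X: "X \<subset> A" using that False Suc.prems(2) by blast
      then have lt: "card X < Suc n" using Suc.prems(1) Suc.hyps(2) by (metis psubset_card_mono)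
      have d: "card (A - X) = Suc n - card X"
        using X Suc.prems(1) Suc.hyps(2) by (metis card_Diff_subset finite_subset psubset_imp_subset)
      have "Suc n * (n choose card X) = (Suc n - card X) * (Suc n choose card X)"
        using binomial_absorb_comp[of "Suc n" "card X"] by simp
      then have "real (Suc n) * real (n choose card X) = real (Suc n - card X) * real (Suc n choose card X)"
        by (metis of_nat_mult)
      moreover have "real (n choose card X) > 0" "real (Suc n choose card X) > 0"
        using lt by (auto simp: zero_less_binomial)
      ultimately show ?thesis unfolding d by (simp add: divide_simps mult.commute)
    qed
    have "real (Suc n) * (\<Sum>X\<in>F. 1 / real (Suc n choose card X))
        = (\<Sum>X\<in>F. real (card (A - X)) / real (n choose card X))"
      by (simp add: sum_distrib_left w)
    also have "\<dots> = (\<Sum>X\<in>F. \<Sum>x\<in>A. if x \<notin> X then 1 / real (n choose card X) else 0)"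
    proof (rule sum.cong[OF refl])
      fix X
      have "(\<Sum>x\<in>A. if x \<notin> X then 1 / real (n choose card X) else 0)
          = (\<Sum>x\<in>A - X. 1 / real (n choose card X))"
        by (rule sum.mono_neutral_cong_right) (use Suc.prems(1) in auto)
      then show "real (card (A - X)) / real (n choose card X) = (\<Sum>x\<in>A. if x \<notin> X then 1 / real (n choose card X) else 0)"
        by simp
    qed
    also have "\<dots> = (\<Sum>x\<in>A. \<Sum>X\<in>F. if x \<notin> X then 1 / real (n choose card X) else 0)"
      by (rule sum.swap)
    also have "\<dots> = (\<Sum>x\<in>A. \<Sum>X\<in>{X\<in>F. x \<notin> X}. 1 / real (n choose card X))"
      by (rule sum.cong[OF refl]) (rule sum.inter_filter[OF finF, symmetric])
    also have "\<dots> \<le> real (card A) * 1"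
      using IH by (intro sum_bounded_above) auto
    finally show ?thesis using Suc.hyps(2) by (metis mult_le_cancel_left_pos of_nat_0_less_iff zero_less_Suc)
  qed
qed

text \<open>Every weight in the LYM sum is at least the reciprocal of the largest binomial
  coefficient, the middle one.\<close>

lemma sperner:
  assumes "finite A" "F \<subseteq> Pow A" "\<And>X Y. X \<in> F \<Longrightarrow> Y \<in> F \<Longrightarrow> X \<subseteq> Y \<Longrightarrow> X = Y"
  shows "card F \<le> card A choose (card A div 2)"
proof -
  let ?B = "real (card A choose (card A div 2))"
  have Bpos: "?B > 0" by simp
  have "real (card F) / ?B = (\<Sum>X\<in>F. 1 / ?B)" by simp
  also have "\<dots> \<le> (\<Sum>X\<in>F. 1 / real (card A choose card X))"
  proof (rule sum_mono)
    fix X assume "X \<in> F"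
    then have "card X \<le> card A" using assms by (auto intro: card_mono)
    then show "1 / ?B \<le> 1 / real (card A choose card X)"
      using binomial_maximum[of "card A" "card X"] by (intro divide_left_mono) auto
  qed
  also have "\<dots> \<le> 1" by (rule lym_inequality[OF assms])
  finally show ?thesis using Bpos by (simp add: divide_simps)
qed

section \<open>Size of the middle binomial coefficient\<close>

text \<open>The factor \<open>2 * n + 1\<close> makes the induction close: consecutive central
  coefficients have ratio \<open>2 (2n + 1) / (n + 1)\<close>, and
  \<open>(2n + 1) (2n + 3) \<le> 4 (n + 1)^2\<close>.\<close>

lemma central_binomial_upper_bound: "(2 * n choose n)\<^sup>2 * (2 * n + 1) \<le> (16::nat) ^ n"
proof (induction n)
  case (Suc n)
  let ?c = "2 * n choose n" and ?d = "2 * Suc n choose Suc n"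
  have rec: "?d * Suc n = 2 * (2 * n + 1) * ?c"
  proof -
    have 1: "Suc n * ?d = 2 * Suc n * (Suc (2 * n) choose n)"
      using Suc_times_binomial_eq[of "Suc (2*n)" n] by (simp add: mult.commute)
    have 2: "Suc n * (Suc (2 * n) choose n) = Suc (2 * n) * ?c"
      using binomial_absorb_comp[of "Suc (2*n)" n] by (simp add: Suc_diff_le)
    have "Suc n * (Suc n * ?d) = 2 * Suc n * (Suc n * (Suc (2 * n) choose n))"
      unfolding 1 by (simp only: ac_simps)
    also have "\<dots> = Suc n * (2 * (2 * n + 1) * ?c)"
      by (simp only: 2) (simp only: Suc_eq_plus1 ac_simps)
    finally have "Suc n * (Suc n * ?d) = Suc n * (2 * (2 * n + 1) * ?c)" .
    then have "Suc n * ?d = 2 * (2 * n + 1) * ?c" by (rule Suc_mult_cancel1[THEN iffD1])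
    then show ?thesis by (subst mult.commute)
  qed
  have "?d\<^sup>2 * (2 * Suc n + 1) * (Suc n)\<^sup>2 = 4 * ((2 * n + 1) * (2 * Suc n + 1)) * (?c\<^sup>2 * (2 * n + 1))"
  proof -
    have sq: "(2 * x * z)\<^sup>2 * y = 4 * (x * y) * (z\<^sup>2 * x)" for x y z :: nat
      by (simp add: power2_eq_square)
    have "?d\<^sup>2 * (2 * Suc n + 1) * (Suc n)\<^sup>2 = (?d * Suc n)\<^sup>2 * (2 * Suc n + 1)"
      by (simp only: power_mult_distrib mult.assoc mult.commute[of "(Suc n)\<^sup>2"])
    also have "\<dots> = 4 * ((2 * n + 1) * (2 * Suc n + 1)) * (?c\<^sup>2 * (2 * n + 1))"
      unfolding rec by (rule sq)
    finally show ?thesis .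
  qed
  also have "\<dots> \<le> 4 * (4 * (Suc n)\<^sup>2) * 16 ^ n"
  proof (rule mult_le_mono[OF mult_le_mono[OF order_refl] Suc])
    show "(2 * n + 1) * (2 * Suc n + 1) \<le> 4 * (Suc n)\<^sup>2"
      by (simp add: power2_eq_square algebra_simps)
  qed
  also have "\<dots> = 16 ^ Suc n * (Suc n)\<^sup>2" by simp
  finally show ?case by simp
qed simp

lemma middle_binomial_upper_bound:
  assumes "n > 0"
  shows "real (n choose (n div 2)) \<le> 2 ^ n / sqrt (real n)"
proof -
  have "(n choose (n div 2))\<^sup>2 * n \<le> 4 ^ n"
  proof (cases "even n")
    case True
    then obtain k where k: "n = 2 * k" by blast
    have "(2 * k choose k)\<^sup>2 * (2 * k) \<le> (2 * k choose k)\<^sup>2 * (2 * k + 1)" by simp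
    also have "\<dots> \<le> 16 ^ k" by (rule central_binomial_upper_bound)
    finally show ?thesis unfolding k by (simp add: power_mult)
  next
    case False
    then obtain k where k: "n = 2 * k + 1" using oddE by blast
    \<comment> \<open>For odd \<open>n\<close> the two equal middle coefficients add up to the next
      central coefficient, which reduces to the even case.\<close>
    have "(2 * Suc k) choose Suc k = 2 * (n choose k)"
      using binomial_symmetric[of "Suc k" "Suc (2 * k)"] unfolding k by simp
    then have "4 * (n choose k)\<^sup>2 * (2 * Suc k + 1) \<le> 16 ^ Suc k"
      using central_binomial_upper_bound[of "Suc k"] by (simp add: power_mult_distrib)
    then have "(n choose k)\<^sup>2 * (2 * Suc k + 1) \<le> 4 * 16 ^ k" by simp
    moreover have "(n choose k)\<^sup>2 * n \<le> (n choose k)\<^sup>2 * (2 * Suc k + 1)" unfolding k by simp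
    ultimately have "(n choose k)\<^sup>2 * n \<le> 4 * 16 ^ k" by linarith
    moreover have "n div 2 = k" "(4::nat) ^ n = 4 * 16 ^ k" unfolding k by (auto simp: power_mult)
    ultimately show ?thesis by simp
  qed
  then have "real (n choose (n div 2)) ^ 2 * real n \<le> 4 ^ n"
    by (metis (mono_tags, lifting) of_nat_le_iff of_nat_mult of_nat_numeral of_nat_power)
  then have "(real (n choose (n div 2)) * sqrt (real n))\<^sup>2 \<le> (2 ^ n)\<^sup>2"
    by (simp add: power_mult_distrib power_mult mult.commute[of n] flip: power_mult[of 2 n 2])
  then have "real (n choose (n div 2)) * sqrt (real n) \<le> 2 ^ n"
    by (rule power2_le_imp_le) simp
  then show ?thesis using assms by (simp add: divide_simps)
qed

section \<open>Signed sums and the Littlewood-Offord inequality\<close>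

text \<open>A sign pattern is encoded by the set of indices carrying a plus sign, so probabilities
  for fair signs become cardinalities of subfamilies of \<open>Pow I\<close>, to which Sperner's
  theorem applies.\<close>

definition sign_sum :: "('i \<Rightarrow> real) \<Rightarrow> 'i set \<Rightarrow> 'i set \<Rightarrow> real" where
  "sign_sum a I U = (\<Sum>i\<in>I. if i \<in> U then a i else - a i)"

lemma sign_sum_Un:
  assumes "finite A" "finite B" "A \<inter> B = {}" "X \<subseteq> A" "Y \<subseteq> B"
  shows "sign_sum a (A \<union> B) (X \<union> Y) = sign_sum a A X + sign_sum a B Y"
  unfolding sign_sum_def using assms by (subst sum.union_disjoint) (auto intro!: arg_cong2[where f="(+)"] sum.cong)

text \<open>This is conditioning in counting form: fix the signs on \<open>B\<close>, count those on
  \<open>A\<close>, and sum.\<close>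

lemma card_Pow_Un_disjoint:
  assumes "finite A" "finite B" "A \<inter> B = {}"
  shows "card {U \<in> Pow (A \<union> B). P U} = (\<Sum>Y\<in>Pow B. card {X \<in> Pow A. P (X \<union> Y)})"
proof -
  have "bij_betw (\<lambda>(Y, X). X \<union> Y) (SIGMA Y:Pow B. {X \<in> Pow A. P (X \<union> Y)}) {U \<in> Pow (A \<union> B). P U}"
  proof (rule bij_betw_byWitness[where f' = "\<lambda>U. (U \<inter> B, U \<inter> A)"])
    show "\<forall>a\<in>{U \<in> Pow (A \<union> B). P U}. (case (a \<inter> B, a \<inter> A) of (Y, X) \<Rightarrow> X \<union> Y) = a" by auto
    show "(\<lambda>U. (U \<inter> B, U \<inter> A)) ` {U \<in> Pow (A \<union> B). P U} \<subseteq> (SIGMA Y:Pow B. {X \<in> Pow A. P (X \<union> Y)})"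
    proof (clarsimp)
      fix U assume "U \<subseteq> A \<union> B" "P U"
      then have "U \<inter> A \<union> U \<inter> B = U" by auto
      then show "P (U \<inter> A \<union> U \<inter> B)" using \<open>P U\<close> by simp
    qed
  qed (use assms in auto)
  then show ?thesis
    using assms by (simp add: bij_betw_same_card[symmetric])
qed

text \<open>The windows \<open>[c + j w, c + (j + 1) w)\<close> with \<open>j < k\<close> cover
  \<open>[c, b]\<close>; strictness of \<open>b - c < k w\<close> puts the endpoint \<open>b\<close>
  inside the last of them.\<close>

lemma card_cover_half_open:
  fixes f :: "'b \<Rightarrow> real"
  assumes "finite F" "w > 0"
    and "\<And>c. card {X \<in> F. c \<le> f X \<and> f X < c + w} \<le> q"
    and "b - c < real k * w"
  shows "card {X \<in> F. c \<le> f X \<and> f X \<le> b} \<le> k * q"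
proof -
  have "{X \<in> F. c \<le> f X \<and> f X \<le> b} \<subseteq> (\<Union>j<k. {X \<in> F. c + real j * w \<le> f X \<and> f X < (c + real j * w) + w})"
  proof clarsimp
    fix X assume X: "X \<in> F" "c \<le> f X" "f X \<le> b"
    define j where "j = nat \<lfloor>(f X - c) / w\<rfloor>"
    have "(f X - c) / w \<ge> 0" using X assms(2) by simp
    then have j: "real j \<le> (f X - c) / w" "(f X - c) / w < real j + 1"
      unfolding j_def by linarith+
    have "real j * w \<le> f X - c" "f X - c < (real j + 1) * w"
      using j assms(2) by (simp_all add: field_simps)
    moreover have "j < k"
    proof -
      have "real j * w < real k * w" using X assms(4) \<open>real j * w \<le> f X - c\<close> by linarith
      then show ?thesis using assms(2) by simp
    qed
    ultimately show "\<exists>j\<in>{..<k}. c + real j * w \<le> f X \<and> f X < c + real j * w + w"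
      by (intro bexI[of _ j]) (auto simp: algebra_simps)
  qed
  then have "card {X \<in> F. c \<le> f X \<and> f X \<le> b}
      \<le> card (\<Union>j<k. {X \<in> F. c + real j * w \<le> f X \<and> f X < (c + real j * w) + w})"
    using assms(1) by (intro card_mono) auto
  also have "\<dots> \<le> (\<Sum>j<k. card {X \<in> F. c + real j * w \<le> f X \<and> f X < (c + real j * w) + w})"
    by (rule card_UN_le) simp
  also have "\<dots> \<le> (\<Sum>j<k. q)" by (intro sum_mono assms(3))
  finally show ?thesis by simp
qed

text \<open>Erdos's argument: enlarging \<open>U\<close> by an index \<open>i\<close> raises the sum
  by \<open>2 * a i \<ge> 2 * b\<close>, so two nested distinct sets cannot share a half-open window
  of length \<open>2 * b\<close>. The family is an antichain.\<close>

lemma littlewood_offord: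
  assumes "finite J" "b > 0" "\<And>i. i \<in> J \<Longrightarrow> b \<le> a i"
  shows "card {U \<in> Pow J. c \<le> sign_sum a J U \<and> sign_sum a J U < c + 2 * b} \<le> card J choose (card J div 2)"
proof (rule sperner)
  fix X Y
  assume "X \<in> {U \<in> Pow J. c \<le> sign_sum a J U \<and> sign_sum a J U < c + 2 * b}"
    and "Y \<in> {U \<in> Pow J. c \<le> sign_sum a J U \<and> sign_sum a J U < c + 2 * b}" and XY: "X \<subseteq> Y"
  then have X: "X \<subseteq> J" "Y \<subseteq> J" and lt: "sign_sum a J Y - sign_sum a J X < 2 * b" by auto
  show "X = Y"
  proof (rule ccontr)
    assume "X \<noteq> Y"
    then obtain i where i: "i \<in> Y" "i \<notin> X" using XY by blast
    have pos: "0 < a j" if "j \<in> J" for j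
      using assms(2) assms(3)[OF that] by linarith
    have "2 * b \<le> 2 * a i" using i X assms(3) by auto
    also have "\<dots> \<le> (\<Sum>j\<in>Y - X. 2 * a j)"
      by (rule member_le_sum[of i "Y - X" "\<lambda>j. 2 * a j"])
        (use i X assms(1,2) pos in \<open>auto intro: finite_subset less_imp_le\<close>)
    also have "\<dots> = (\<Sum>j\<in>J. (if j \<in> Y then a j else - a j) - (if j \<in> X then a j else - a j))"
      by (rule sum.mono_neutral_cong_left) (use X XY assms(1) in auto)
    also have "\<dots> = sign_sum a J Y - sign_sum a J X"
      by (simp add: sign_sum_def sum_subtractf)
    finally show False using lt by simp
  qed
qed (use assms in auto)


section \<open>Signed sums over doubling chains\<close>

text \<open>Doubling gives \<open>b k \<le> b (Suc k) - b k\<close>, which telescopes. The term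
  \<open>- b 1\<close> is kept because it becomes the gap between distinct signed sums.\<close>

lemma doubling_sum_le:
  fixes b :: "nat \<Rightarrow> real"
  assumes "\<And>k. 1 \<le> k \<Longrightarrow> k < K \<Longrightarrow> 2 * b k \<le> b (Suc k)" "1 \<le> k" "k \<le> K"
  shows "(\<Sum>j = 1..<k. b j) \<le> b k - b 1"
  using assms(2,3)
proof (induction k rule: dec_induct)
  case (step k)
  then show ?case using assms(1)[of k] by simp
qed simp

text \<open>At the last chain position \<open>m\<close> where \<open>X\<close> and \<open>Y\<close>
  differ, the difference gets a term of size \<open>2 * a (i m)\<close>; all earlier positions
  together contribute at most \<open>2 * (a (i m) - a (i 1))\<close>.\<close>

lemma sign_sum_chain_separated:
  assumes inj: "inj_on i {1..K}"
    and dbl: "\<And>k. 1 \<le> k \<Longrightarrow> k < K \<Longrightarrow> 2 * a (i k) \<le> a (i (Suc k))"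
    and pos: "\<And>k. 1 \<le> k \<Longrightarrow> k \<le> K \<Longrightarrow> 0 \<le> a (i k)"
    and X: "X \<subseteq> i ` {1..K}" and Y: "Y \<subseteq> i ` {1..K}" and ne: "X \<noteq> Y"
  shows "2 * a (i 1) \<le> \<bar>sign_sum a (i ` {1..K}) X - sign_sum a (i ` {1..K}) Y\<bar>"
proof -
  \<comment> \<open>\<open>d k\<close>, one of -1, 0 and 1, is half the difference of the two signs
    at \<open>i k\<close>.\<close>
  define d :: "nat \<Rightarrow> real" where "d k = of_bool (i k \<in> X) - of_bool (i k \<in> Y)" for k
  define D where "D = {k \<in> {1..K}. d k \<noteq> 0}"
  have "D \<noteq> {}"
  proof -
    obtain x where "x \<in> X \<and> x \<notin> Y \<or> x \<in> Y \<and> x \<notin> X" using ne by blast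
    then obtain k where "k \<in> {1..K}" "i k \<in> X \<and> i k \<notin> Y \<or> i k \<in> Y \<and> i k \<notin> X"
      using X Y by blast
    then have "k \<in> D" unfolding D_def d_def by auto
    then show ?thesis by blast
  qed
  moreover have "finite D" unfolding D_def by simp
  ultimately have M: "Max D \<in> D" "\<And>k. k \<in> D \<Longrightarrow> k \<le> Max D" by auto
  define m where "m = Max D"
  have m: "1 \<le> m" "m \<le> K" "d m \<noteq> 0" using M(1) unfolding m_def D_def by auto
  have z: "d k = 0" if "m < k" "k \<le> K" for k
  proof (rule ccontr)
    assume "d k \<noteq> 0"
    then have "k \<in> D" using that m(1) unfolding D_def by simp
    then show False using M(2)[of k] that unfolding m_def by simp
  qed
  have "sign_sum a (i ` {1..K}) X - sign_sum a (i ` {1..K}) Y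
      = (\<Sum>k\<in>{1..K}. 2 * d k * a (i k))"
    unfolding sign_sum_def sum.reindex[OF inj] sum_subtractf[symmetric]
    by (rule sum.cong) (auto simp: d_def)
  also have "\<dots> = (\<Sum>k\<in>{1..m}. 2 * d k * a (i k))"
    by (rule sum.mono_neutral_right) (use m z in auto)
  also have "\<dots> = (\<Sum>k\<in>{1..<m}. 2 * d k * a (i k)) + 2 * d m * a (i m)"
    using m(1) by (simp add: sum.last_plus)
  finally have eq: "sign_sum a (i ` {1..K}) X - sign_sum a (i ` {1..K}) Y
    = (\<Sum>k\<in>{1..<m}. 2 * d k * a (i k)) + 2 * d m * a (i m)" .
  have "\<bar>\<Sum>k\<in>{1..<m}. 2 * d k * a (i k)\<bar> \<le> (\<Sum>k\<in>{1..<m}. 2 * a (i k))"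
  proof (rule order_trans[OF sum_abs], rule sum_mono)
    fix k assume "k \<in> {1..<m}"
    then have "0 \<le> a (i k)" using pos m by auto
    moreover have "\<bar>d k\<bar> \<le> 1" unfolding d_def by auto
    ultimately show "\<bar>2 * d k * a (i k)\<bar> \<le> 2 * a (i k)"
      by (simp add: abs_mult mult_left_le_one_le)
  qed
  also have "\<dots> \<le> 2 * (a (i m) - a (i 1))"
    using doubling_sum_le[of K "\<lambda>k. a (i k)" m] dbl m by (simp add: sum_distrib_left[symmetric])
  finally have 1: "\<bar>\<Sum>k\<in>{1..<m}. 2 * d k * a (i k)\<bar> \<le> 2 * (a (i m) - a (i 1))" .
  have "\<bar>d m\<bar> = 1" using m(3) unfolding d_def by auto
  then have 2: "\<bar>2 * d m * a (i m)\<bar> = 2 * a (i m)" using pos m by (simp add: abs_mult)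
  have "2 * y \<le> \<bar>u + v\<bar>" if "\<bar>u\<bar> \<le> 2 * (x - y)" "\<bar>v\<bar> = 2 * x" for u v x y :: real
    using that by (smt (verit))
  from this[OF 1 2] show ?thesis unfolding eq .
qed

text \<open>The terms before the last add up to at most the last one. This limits how far the chain
  can move the sum of the remaining terms.\<close>

lemma abs_sign_sum_chain_le:
  assumes inj: "inj_on i {1..K}" and "K > 0"
    and dbl: "\<And>k. 1 \<le> k \<Longrightarrow> k < K \<Longrightarrow> 2 * a (i k) \<le> a (i (Suc k))"
    and pos: "\<And>k. 1 \<le> k \<Longrightarrow> k \<le> K \<Longrightarrow> 0 \<le> a (i k)"
  shows "\<bar>sign_sum a (i ` {1..K}) X\<bar> \<le> 2 * a (i K)"
proof -
  have "\<bar>sign_sum a (i ` {1..K}) X\<bar> \<le> (\<Sum>k\<in>{1..K}. a (i k))"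
    unfolding sign_sum_def sum.reindex[OF inj]
    by (rule order_trans[OF sum_abs], rule sum_mono) (use pos in auto)
  also have "\<dots> = (\<Sum>k\<in>{1..<K}. a (i k)) + a (i K)"
    using assms(2) by (simp add: sum.last_plus)
  also have "\<dots> \<le> (a (i K) - a (i 1)) + a (i K)"
    using doubling_sum_le[of K "\<lambda>k. a (i k)" K] dbl assms(2) by simp
  finally show ?thesis using pos[of 1] assms(2) by simp
qed

text \<open>By separation each half-open window of length \<open>2 * c\<close> holds at most one
  signed sum, and \<open>q\<close> such windows cover \<open>[u, v]\<close>.\<close>

lemma card_chain_sign_sum_le:
  assumes inj: "inj_on i {1..K}" and "K > 0" and "c > 0"
    and dbl: "\<And>k. 1 \<le> k \<Longrightarrow> k < K \<Longrightarrow> 2 * a (i k) \<le> a (i (Suc k))"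
    and low: "\<And>k. 1 \<le> k \<Longrightarrow> k \<le> K \<Longrightarrow> c \<le> a (i k)"
    and "v - u < real q * (2 * c)"
  shows "card {X \<in> Pow (i ` {1..K}). u \<le> sign_sum a (i ` {1..K}) X \<and> sign_sum a (i ` {1..K}) X \<le> v} \<le> q"
proof -
  let ?C = "i ` {1..K}"
  have "card {X \<in> Pow ?C. w \<le> sign_sum a ?C X \<and> sign_sum a ?C X < w + 2 * c} \<le> 1" for w
  proof -
    have "X = Y" if "X \<subseteq> ?C" "Y \<subseteq> ?C"
      and s: "w \<le> sign_sum a ?C X" "sign_sum a ?C X < w + 2 * c"
        "w \<le> sign_sum a ?C Y" "sign_sum a ?C Y < w + 2 * c" for X Y
    proof -
      have "0 \<le> a (i k)" if "1 \<le> k" "k \<le> K" for k using low[OF that] assms(3) by simp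
      then have "X \<noteq> Y \<Longrightarrow> 2 * a (i 1) \<le> \<bar>sign_sum a ?C X - sign_sum a ?C Y\<bar>"
        using that by (intro sign_sum_chain_separated[OF inj dbl]) auto
      moreover have "c \<le> a (i 1)" using low[of 1] assms(2) by simp
      ultimately show ?thesis using s by linarith
    qed
    then show ?thesis unfolding One_nat_def by (subst card_le_Suc0_iff_eq) auto
  qed
  from card_cover_half_open[OF _ _ this assms(6)] assms(3) show ?thesis by simp
qed

section \<open>Concentration of the full signed sum\<close>

text \<open>The indices split into the chain \<open>C\<close>, the block \<open>J\<close> of large
  terms and the rest \<open>E\<close>. Given the signs on \<open>E\<close>, Littlewood-Offord limits
  those on \<open>J\<close>; given all signs off the chain, separation limits those on
  \<open>C\<close>. The signs on \<open>E\<close> stay free.\<close>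

lemma sign_sum_concentration:
  fixes a :: "nat \<Rightarrow> real"
  assumes chain: "doubling_chain a m K i" and "K > 0" and "m \<le> n"
    and "c > 0" and low: "\<And>j. j \<ge> 1 \<Longrightarrow> c \<le> a j"
    and J: "J \<subseteq> {m<..n}" "J \<noteq> {}" and "b > 0" and big: "\<And>j. j \<in> J \<Longrightarrow> b \<le> a j"
    and q: "2 * R < real q * (2 * c)" and p: "2 * (R + 2 * a m) < real p * (2 * b)"
  shows "real (card {U \<in> Pow {1..n}. \<bar>sign_sum a {1..n} U\<bar> \<le> R}) / 2 ^ n
    \<le> real q * real p / (2 ^ K * sqrt (real (card J)))"
proof -
  define C where "C = i ` {1..K}"
  define E where "E = {1..n} - C - J"
  have inj: "inj_on i {1..K}" and C: "C \<subseteq> {1..m}" and iK: "i K = m"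
    and dbl: "\<And>k. 1 \<le> k \<Longrightarrow> k < K \<Longrightarrow> 2 * a (i k) \<le> a (i (Suc k))"
    using chain unfolding doubling_chain_def C_def by auto
  have lowC: "c \<le> a (i k)" if "1 \<le> k" "k \<le> K" for k
    using C that unfolding C_def by (intro low) force
  have fin: "finite C" "finite J" "finite E"
    using J(1) finite_subset unfolding C_def E_def by auto
  \<comment> \<open>The chain stays in \<open>{1..m}\<close> and \<open>J\<close> lies beyond
    \<open>m\<close>.\<close>
  have CJ: "C \<inter> J = {}" using C J(1) by force
  have disj: "C \<inter> (J \<union> E) = {}" "J \<inter> E = {}" using CJ unfolding E_def by auto
  have un: "{1..n} = C \<union> (J \<union> E)" using C J(1) assms(3) unfolding E_def by force
  have cardC: "card C = K" unfolding C_def using card_image[OF inj] by simp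
  have "card {1..n} = card C + (card J + card E)"
    unfolding un using fin disj by (simp add: card_Un_disjoint)
  then have n: "n = K + (card J + card E)" using cardC by simp

  define B where "B = card J choose (card J div 2)"
  \<comment> \<open>Fixed signs on \<open>E\<close> only shift the target interval, which
    \<open>p\<close> windows of length \<open>2 * b\<close> cover.\<close>
  have inner: "card {X \<in> Pow J. \<bar>sign_sum a (J \<union> E) (X \<union> Z)\<bar> \<le> R + 2 * a m} \<le> p * B"
    if "Z \<in> Pow E" for Z
  proof -
    define t where "t = sign_sum a E Z"
    have "{X \<in> Pow J. \<bar>sign_sum a (J \<union> E) (X \<union> Z)\<bar> \<le> R + 2 * a m}
        = {X \<in> Pow J. - (R + 2 * a m) - t \<le> sign_sum a J X \<and> sign_sum a J X \<le> R + 2 * a m - t}"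
      using that fin disj by (auto simp: sign_sum_Un t_def)
    also have "card \<dots> \<le> p * B"
      by (rule card_cover_half_open[where w = "2 * b"])
        (use fin assms(8) p littlewood_offord[OF fin(2) assms(8) big] B_def in \<open>auto simp: algebra_simps\<close>)
    finally show ?thesis .
  qed
  have "card {Y \<in> Pow (J \<union> E). \<bar>sign_sum a (J \<union> E) Y\<bar> \<le> R + 2 * a m}
      = (\<Sum>Z\<in>Pow E. card {X \<in> Pow J. \<bar>sign_sum a (J \<union> E) (X \<union> Z)\<bar> \<le> R + 2 * a m})"
    by (rule card_Pow_Un_disjoint) (use fin disj in auto)
  also have "\<dots> \<le> (\<Sum>Z\<in>Pow E. p * B)" by (rule sum_mono[OF inner])
  also have "\<dots> = 2 ^ card E * (p * B)" using fin by (simp add: card_Pow)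
  finally have JE: "card {Y \<in> Pow (J \<union> E). \<bar>sign_sum a (J \<union> E) Y\<bar> \<le> R + 2 * a m} \<le> 2 ^ card E * (p * B)" .

  \<comment> \<open>If the sum off the chain exceeds \<open>R + 2 * a m\<close> in absolute value,
    no choice of chain signs brings the total back to \<open>[-R, R]\<close>; otherwise at most
    \<open>q\<close> choices do.\<close>
  have outer: "card {X \<in> Pow C. \<bar>sign_sum a {1..n} (X \<union> Y)\<bar> \<le> R}
      \<le> (if \<bar>sign_sum a (J \<union> E) Y\<bar> \<le> R + 2 * a m then q else 0)" if "Y \<in> Pow (J \<union> E)" for Y
  proof -
    define t where "t = sign_sum a (J \<union> E) Y"
    have eq: "{X \<in> Pow C. \<bar>sign_sum a {1..n} (X \<union> Y)\<bar> \<le> R}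
        = {X \<in> Pow C. - R - t \<le> sign_sum a C X \<and> sign_sum a C X \<le> R - t}"
      unfolding un using that fin disj by (auto simp: sign_sum_Un t_def)
    have "\<bar>sign_sum a C X\<bar> \<le> 2 * a m" for X
      using abs_sign_sum_chain_le[OF inj assms(2), of a X] dbl lowC assms(4) iK
      unfolding C_def[symmetric] by (meson less_imp_le order_trans)
    then have "{X \<in> Pow C. - R - t \<le> sign_sum a C X \<and> sign_sum a C X \<le> R - t} = {}"
      if "\<not> \<bar>t\<bar> \<le> R + 2 * a m" using that by (smt (verit) Collect_empty_eq)
    moreover have "card {X \<in> Pow C. - R - t \<le> sign_sum a C X \<and> sign_sum a C X \<le> R - t} \<le> q"
      unfolding C_def by (rule card_chain_sign_sum_le[OF inj assms(2,4) dbl lowC]) (use q in auto)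
    ultimately show ?thesis unfolding eq t_def[symmetric]
      by (smt (verit, best) card.empty order_refl)
  qed
  have "card {U \<in> Pow {1..n}. \<bar>sign_sum a {1..n} U\<bar> \<le> R}
      = (\<Sum>Y\<in>Pow (J \<union> E). card {X \<in> Pow C. \<bar>sign_sum a {1..n} (X \<union> Y)\<bar> \<le> R})"
    by (subst (1) un, rule card_Pow_Un_disjoint) (use fin disj in auto)
  also have "\<dots> \<le> (\<Sum>Y\<in>Pow (J \<union> E). if \<bar>sign_sum a (J \<union> E) Y\<bar> \<le> R + 2 * a m then q else 0)"
    by (rule sum_mono[OF outer])
  also have "\<dots> = card {Y \<in> Pow (J \<union> E). \<bar>sign_sum a (J \<union> E) Y\<bar> \<le> R + 2 * a m} * q"
    using fin by (subst sum.inter_filter[symmetric]) auto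
  also have "\<dots> \<le> 2 ^ card E * (p * B) * q" using JE by simp
  finally have "card {U \<in> Pow {1..n}. \<bar>sign_sum a {1..n} U\<bar> \<le> R} \<le> 2 ^ card E * (p * B) * q" .
  then have "real (card {U \<in> Pow {1..n}. \<bar>sign_sum a {1..n} U\<bar> \<le> R}) \<le> 2 ^ card E * (real p * real B) * real q"
    by (metis (mono_tags, lifting) of_nat_le_iff of_nat_mult of_nat_numeral of_nat_power)
  also have "\<dots> \<le> 2 ^ card E * (real p * (2 ^ card J / sqrt (real (card J)))) * real q"
    unfolding B_def using J(2) fin
    by (intro mult_right_mono mult_left_mono middle_binomial_upper_bound) (auto simp: card_gt_0_iff)
  finally have "real (card {U \<in> Pow {1..n}. \<bar>sign_sum a {1..n} U\<bar> \<le> R})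
    \<le> 2 ^ card E * (real p * (2 ^ card J / sqrt (real (card J)))) * real q" .
  then have "real (card {U \<in> Pow {1..n}. \<bar>sign_sum a {1..n} U\<bar> \<le> R}) / 2 ^ n
    \<le> 2 ^ card E * (real p * (2 ^ card J / sqrt (real (card J)))) * real q / 2 ^ n"
    by (rule divide_right_mono) simp
  also have "\<dots> = real q * real p / (2 ^ K * sqrt (real (card J)))"
  proof -
    have "(2::real) ^ n = 2 ^ K * (2 ^ card J * 2 ^ card E)" by (subst n) (simp add: power_add)
    then show ?thesis by (simp add: mult.commute)
  qed
  finally show ?thesis .
qed

section \<open>Convergence of the comparison series\<close>

text \<open>Cauchy condensation leaves a series dominated by a multiple of
  \<open>n powr (- p)\<close>. The shift inside \<open>ln\<close> keeps the term at 1 from being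
  \<open>1 / 0 = 0\<close>, which would break monotonicity.\<close>

lemma summable_inverse_mult_ln_powr:
  assumes "p > 1"
  shows "summable (\<lambda>n. 1 / (real n * ln (real n + 1) powr p))"
proof (subst condensation_test)
  show "1 / (real (Suc m) * ln (real (Suc m) + 1) powr p) \<le> 1 / (real m * ln (real m + 1) powr p)"
    if "0 < m" for m
    using that assms by (intro divide_left_mono mult_mono powr_mono2) auto
  have bound: "norm (2 ^ n * (1 / (real (2 ^ n) * ln (real (2 ^ n) + 1) powr p)))
      \<le> ln 2 powr (- p) * real n powr (- p)" if "n \<ge> 1" for n
  proof -
    have "real n * ln 2 = ln (2 ^ n)" by (simp add: ln_realpow)
    also have "\<dots> \<le> ln (real (2 ^ n) + 1)" by (simp add: add_pos_pos)
    finally have "(real n * ln 2) powr p \<le> ln (real (2 ^ n) + 1) powr p"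
      using assms by (intro powr_mono2) auto
    moreover have "(real n * ln 2) powr p > 0" using that by simp
    ultimately have "1 / ln (real (2 ^ n) + 1) powr p \<le> 1 / (real n * ln 2) powr p"
      by (intro divide_left_mono mult_pos_pos) auto
    also have "\<dots> = ln 2 powr (- p) * real n powr (- p)"
      by (simp add: powr_mult powr_minus field_simps)
    finally show ?thesis by simp
  qed
  have "summable (\<lambda>n. ln 2 powr (- p) * real n powr (- p))"
    using assms by (intro summable_mult) (simp add: summable_real_powr_iff)
  then show "summable (\<lambda>n. 2 ^ n * (1 / (real (2 ^ n) * ln (real (2 ^ n) + 1) powr p)))"
    using bound by (rule summable_comparison_test')
qed (use assms in auto)

section \<open>From the planar walk to signed sums\<close>

text \<open>The four prescribed atoms already have total mass 1.\<close>

lemma (in prob_space) AE_rademacher2: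
  assumes "rademacher2 M X"
  shows "AE \<omega> in M. X \<omega> \<in> {(1, 0), (0, 1), - (1, 0), - (0, 1)}"
proof -
  let ?V = "{(1, 0), (0, 1), - (1, 0), - (0, 1)} :: (real \<times> real) set"
  let ?A = "\<lambda>v. {\<omega> \<in> space M. X \<omega> = v}"
  have meas [measurable]: "X \<in> borel_measurable M" and pr: "\<And>v. v \<in> ?V \<Longrightarrow> prob (?A v) = 1 / 4"
    using assms unfolding rademacher2_def by auto
  have A: "?A v \<in> events" for v by measurable
  have "prob (\<Union>v\<in>?V. ?A v) = (\<Sum>v\<in>?V. prob (?A v))"
    by (rule finite_measure_finite_Union) (use A in \<open>auto simp: disjoint_family_on_def\<close>)
  also have "\<dots> = (\<Sum>v\<in>?V. 1 / 4)" by (rule sum.cong[OF refl pr])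
  also have "\<dots> = 1" by simp
  finally have "AE \<omega> in M. \<omega> \<in> (\<Union>v\<in>?V. ?A v)"
    using A by (subst (asm) prob_eq_1) auto
  then show ?thesis by eventually_elim auto
qed

text \<open>A step is determined by the signs \<open>x + y\<close> and \<open>x - y\<close>, so
  pairs \<open>(U, V)\<close> of subsets encode the \<open>4 ^ n\<close> paths, each of probability
  \<open>1 / 4 ^ n\<close>. A small norm makes both signed sums small, hence the pair lies in
  \<open>G \<times> G\<close>; this is where the square comes from.\<close>

lemma (in prob_space) prob_walk2_le:
  fixes a :: "nat \<Rightarrow> real"
  assumes iid: "iid_rademacher2 M \<xi>"
  shows "prob {\<omega> \<in> space M. norm (walk2 a \<xi> n \<omega>) \<le> R}
    \<le> (real (card {U \<in> Pow {1..n}. \<bar>sign_sum a {1..n} U\<bar> \<le> 2 * R}) / 2 ^ n)\<^sup>2"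
proof -
  define sg :: "bool \<Rightarrow> real" where "sg b = (if b then 1 else - 1)" for b
  \<comment> \<open>\<open>w b c\<close> is the step with coordinate sum \<open>sg b\<close> and
    coordinate difference \<open>sg c\<close>.\<close>
  define w :: "bool \<Rightarrow> bool \<Rightarrow> real \<times> real" where
    "w b c = ((sg b + sg c) / 2, (sg b - sg c) / 2)" for b c
  define G where "G = {U \<in> Pow {1..n}. \<bar>sign_sum a {1..n} U\<bar> \<le> 2 * R}"
  define E where "E = (\<lambda>(U, V). {\<omega> \<in> space M. \<forall>i\<in>{1..n}. \<xi> i \<omega> = w (i \<in> U) (i \<in> V)})"
  have ind: "indep_vars (\<lambda>_. borel) \<xi> {1..}" and rad: "\<And>i. i \<ge> 1 \<Longrightarrow> rademacher2 M (\<xi> i)"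
    using iid unfolding iid_rademacher2_def by auto
  have rv: "\<xi> i \<in> borel_measurable M" if "i \<in> {1..n}" for i
    using rad that unfolding rademacher2_def by auto
  have wV: "w b c \<in> {(1, 0), (0, 1), - (1, 0), - (0, 1)}" for b c
    by (cases b; cases c) (auto simp: w_def sg_def)
  have pr: "prob {\<omega> \<in> space M. \<xi> i \<omega> = w b c} = 1 / 4" if "i \<in> {1..n}" for i b c
    using rad[of i] that wV[of b c] unfolding rademacher2_def by auto
  have E_eq: "E UV = (\<Inter>i\<in>{1..n}. \<xi> i -` {w (i \<in> fst UV) (i \<in> snd UV)} \<inter> space M)" if "n > 0" for UV
    using that unfolding E_def by (auto split: prod.splits)
  have E_meas: "E UV \<in> events" for UV
  \<comment> \<open>For \<open>n = 0\<close> the intersection over the empty index set would be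
    \<open>UNIV\<close> instead of \<open>space M\<close>.\<close>
  proof (cases "n = 0")
    case True
    then show ?thesis unfolding E_def by (auto split: prod.splits)
  next
    case False
    then show ?thesis unfolding E_eq[OF False[unfolded neq0_conv]]
      using rv by (intro sets.finite_INT measurable_sets[where A = borel]) auto
  qed
  have E_prob: "prob (E UV) = 1 / 4 ^ n" for UV
  proof (cases "n = 0")
    case True
    then show ?thesis unfolding E_def by (auto split: prod.splits simp: prob_space)
  next
    case False
    then have "prob (E UV) = (\<Prod>i\<in>{1..n}. prob (\<xi> i -` {w (i \<in> fst UV) (i \<in> snd UV)} \<inter> space M))"
      unfolding E_eq[OF False[unfolded neq0_conv]] by (intro indep_varsD[OF ind]) auto
    also have "\<dots> = (\<Prod>i\<in>{1..n}. 1 / 4)"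
    proof (rule prod.cong[OF refl])
      fix i assume "i \<in> {1..n}"
      moreover have "\<xi> i -` {w (i \<in> fst UV) (i \<in> snd UV)} \<inter> space M
        = {\<omega> \<in> space M. \<xi> i \<omega> = w (i \<in> fst UV) (i \<in> snd UV)}" by auto
      ultimately show "prob (\<xi> i -` {w (i \<in> fst UV) (i \<in> snd UV)} \<inter> space M) = 1 / 4"
        using pr by simp
    qed
    finally show ?thesis by (simp add: power_one_over)
  qed
  have "AE \<omega> in M. \<forall>i\<in>{1..n}. \<xi> i \<omega> \<in> {(1, 0), (0, 1), - (1, 0), - (0, 1)}"
    by (intro AE_finite_allI AE_rademacher2 rad) auto
  then have "AE \<omega> in M. \<omega> \<in> {\<omega> \<in> space M. norm (walk2 a \<xi> n \<omega>) \<le> R} \<longrightarrow> \<omega> \<in> (\<Union>UV\<in>G \<times> G. E UV)"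
  proof eventually_elim
    case (elim \<omega>)
    define U where "U = {i \<in> {1..n}. fst (\<xi> i \<omega>) + snd (\<xi> i \<omega>) = 1}"
    define V where "V = {i \<in> {1..n}. fst (\<xi> i \<omega>) - snd (\<xi> i \<omega>) = 1}"
    have xi: "\<xi> i \<omega> = w (i \<in> U) (i \<in> V)" "(if i \<in> U then a i else - a i) = a i * (fst (\<xi> i \<omega>) + snd (\<xi> i \<omega>))"
      "(if i \<in> V then a i else - a i) = a i * (fst (\<xi> i \<omega>) - snd (\<xi> i \<omega>))" if "i \<in> {1..n}" for i
      using bspec[OF elim that] that unfolding U_def V_def w_def sg_def by auto
    have S: "sign_sum a {1..n} U = fst (walk2 a \<xi> n \<omega>) + snd (walk2 a \<xi> n \<omega>)"
      "sign_sum a {1..n} V = fst (walk2 a \<xi> n \<omega>) - snd (walk2 a \<xi> n \<omega>)"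
      using xi(2,3) unfolding sign_sum_def walk2_def
      by (simp_all add: fst_sum snd_sum ring_distribs sum.distrib sum_subtractf)
    show ?case
    proof
      assume "\<omega> \<in> {\<omega> \<in> space M. norm (walk2 a \<xi> n \<omega>) \<le> R}"
      then have om: "\<omega> \<in> space M" and "norm (walk2 a \<xi> n \<omega>) \<le> R" by auto
      moreover have "\<bar>fst (walk2 a \<xi> n \<omega>)\<bar> \<le> norm (walk2 a \<xi> n \<omega>)"
        "\<bar>snd (walk2 a \<xi> n \<omega>)\<bar> \<le> norm (walk2 a \<xi> n \<omega>)"
        by (metis norm_fst_le prod.collapse real_norm_def) (metis norm_snd_le prod.collapse real_norm_def)
      \<comment> \<open>Each coordinate is at most \<open>R\<close> in absolute value, so their sum
        and difference are at most \<open>2 * R\<close>.\<close>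
      ultimately have "\<bar>sign_sum a {1..n} U\<bar> \<le> 2 * R" "\<bar>sign_sum a {1..n} V\<bar> \<le> 2 * R"
        unfolding S by linarith+
      then have "(U, V) \<in> G \<times> G" unfolding G_def U_def V_def by auto
      moreover have "\<omega> \<in> E (U, V)" unfolding E_def using om xi(1) by auto
      ultimately show "\<omega> \<in> (\<Union>UV\<in>G \<times> G. E UV)" by blast
    qed
  qed
  moreover have finG: "finite G" unfolding G_def by simp
  ultimately have "prob {\<omega> \<in> space M. norm (walk2 a \<xi> n \<omega>) \<le> R} \<le> prob (\<Union>UV\<in>G \<times> G. E UV)"
    using E_meas by (intro finite_measure_mono_AE sets.finite_UN) auto
  also have "\<dots> \<le> (\<Sum>UV\<in>G \<times> G. prob (E UV))"
    using E_meas finG by (intro finite_measure_subadditive_finite) auto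
  also have "\<dots> = (real (card G) / 2 ^ n)\<^sup>2"
    unfolding E_prob by (simp add: card_cartesian_product power2_eq_square flip: power_mult_distrib)
  finally show ?thesis unfolding G_def .
qed

section \<open>Choice of parameters for large n\<close>

text \<open>Only finitely many terms can lie below 1. A uniform \<open>c\<close> bounds the first
  term of every chain from below, so one window length serves for all \<open>n\<close>.\<close>

lemma positive_lower_bound:
  fixes a :: "nat \<Rightarrow> real"
  assumes pos: "\<And>n. n \<ge> 1 \<Longrightarrow> a n > 0" and lim: "filterlim a at_top sequentially"
  obtains c where "c > 0" "\<And>n. n \<ge> 1 \<Longrightarrow> c \<le> a n"
proof -
  obtain N where N: "\<And>n. n \<ge> N \<Longrightarrow> 1 \<le> a n"
    using lim unfolding filterlim_at_top eventually_sequentially by blast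
  define c where "c = Min (insert 1 (a ` {1..N}))"
  have "c > 0" unfolding c_def using pos by auto
  moreover have "c \<le> a n" if "n \<ge> 1" for n
  proof (cases "n \<ge> N")
    case True
    have "c \<le> 1" unfolding c_def by simp
    then show ?thesis using N[OF True] by simp
  next
    case False
    then show ?thesis unfolding c_def using that by (intro Min_le) auto
  qed
  ultimately show ?thesis using that by blast
qed

lemma sign_sum_concentration_eventually:
  fixes a :: "nat \<Rightarrow> real"
  assumes pos: "\<And>n. n \<ge> 1 \<Longrightarrow> a n > 0" and good: "good_seq a"
    and r: "r \<ge> 1" and s: "s \<ge> 1" and mono: "rs_monotone r s a"
    and eps: "\<epsilon> > 0"
    and growth: "\<forall>\<^sub>F n in sequentially. a n \<ge> ln (real n) powr (1 / 2 + \<epsilon>)"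
    and R: "R > 0"
  obtains D where "\<forall>\<^sub>F n in sequentially.
    (real (card {U \<in> Pow {1..n}. \<bar>sign_sum a {1..n} U\<bar> \<le> R}) / 2 ^ n)\<^sup>2
      \<le> D * (1 / (real n * ln (real n + 1) powr (1 + \<epsilon>)))"
proof -
  have "filterlim (\<lambda>n. ln (real n) powr (1 / 2 + \<epsilon>)) at_top sequentially"
    using eps by real_asymp
  then have lim: "filterlim a at_top sequentially"
    using growth by (rule filterlim_at_top_mono)
  obtain c where c: "c > 0" "\<And>n. n \<ge> 1 \<Longrightarrow> c \<le> a n"
    using positive_lower_bound[OF pos lim] by blast
  obtain K where chains: "\<forall>\<^sub>F n in sequentially. K n > 0 \<and> (\<exists>i. doubling_chain a n (K n) i)"
    and Klim: "(\<lambda>n. real (K n) / log 2 (a n)) \<longlonglongrightarrow> 1"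
    using good unfolding good_seq_def by blast
  \<comment> \<open>The chain length is only asymptotic to \<open>log 2 (a n)\<close>, so some
    exponent is lost. This \<open>\<theta> < 1\<close> lowers the squared growth exponent from
    \<open>1 + 2 * \<epsilon>\<close> to \<open>1 + \<epsilon>\<close>, still above 1.\<close>
  define \<theta> where "\<theta> = (1 + \<epsilon>) / (1 + 2 * \<epsilon>)"
  have \<theta>: "\<theta> > 0" "\<theta> < 1" "2 * ((1 / 2 + \<epsilon>) * \<theta>) = 1 + \<epsilon>"
    using eps unfolding \<theta>_def by (simp_all add: divide_simps)
  define q where "q = nat \<lceil>R / c\<rceil> + 1"
  have q: "2 * R < real q * (2 * c)"
  proof -
    have "R / c < real q" unfolding q_def using R c(1) by linarith
    then show ?thesis using c(1) by (simp add: divide_simps mult.commute)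
  qed
  \<comment> \<open>Once \<open>a m > R\<close>, the interval for the sum off the chain has length
    below \<open>6 * a m\<close>; windows of length \<open>2 * a m / s\<close> then number about
    \<open>3 * s\<close>, independently of \<open>n\<close>.\<close>
  define p where "p = nat \<lceil>3 * s\<rceil> + 1"
  have p: "3 * s < real p" unfolding p_def by linarith
  \<comment> \<open>With this choice \<open>r * m \<le> n / 2\<close>, so monotonicity compares
    \<open>a m\<close> with every term in the upper half of \<open>{1..n}\<close>.\<close>
  define m where "m n = nat \<lfloor>real n / (2 * r)\<rfloor>" for n
  have m_lim: "filterlim m at_top sequentially"
    unfolding m_def using r by real_asymp
  have ev1: "\<forall>\<^sub>F m in sequentially. K m > 0 \<and> (\<exists>i. doubling_chain a m (K m) i) \<and>
      real (K m) / log 2 (a m) > \<theta> \<and> a m \<ge> ln (real m) powr (1 / 2 + \<epsilon>) \<and>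
      (\<forall>j. real j \<ge> r * real m \<longrightarrow> a m \<le> s * a j) \<and> a m > max R 1 \<and> m \<ge> 1"
    using chains order_tendstoD(1)[OF Klim \<theta>(2)] growth mono[unfolded rs_monotone_def]
      filterlim_at_top_dense[THEN iffD1, OF lim, rule_format, of "max R 1"] eventually_ge_at_top[of 1]
    by eventually_elim blast
  \<comment> \<open>Passing from \<open>n\<close> to \<open>m\<close> costs the logarithm only a
    bounded amount, so half of it certainly survives.\<close>
  have "\<forall>\<^sub>F n in sequentially. ln (real n + 1) / 2 \<le> ln (real_of_int \<lfloor>real n / (2 * r)\<rfloor>)"
    using r by real_asymp
  then have ev2: "\<forall>\<^sub>F n in sequentially. ln (real n + 1) / 2 \<le> ln (real (m n))"
    by eventually_elim (use r in \<open>simp add: m_def\<close>)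
  \<comment> \<open>The factor 2 comes from \<open>card J \<ge> n / 2\<close>, the power of 2 from
    the halved logarithm.\<close>
  define D where "D = (real q * real p)\<^sup>2 * 2 * 2 powr (1 + \<epsilon>)"
  have "\<forall>\<^sub>F n in sequentially.
    (real (card {U \<in> Pow {1..n}. \<bar>sign_sum a {1..n} U\<bar> \<le> R}) / 2 ^ n)\<^sup>2
      \<le> D * (1 / (real n * ln (real n + 1) powr (1 + \<epsilon>)))"
    using eventually_compose_filterlim[OF ev1 m_lim] ev2 eventually_ge_at_top[of 1]
  proof eventually_elim
    case (elim n)
    define \<mu> where "\<mu> = m n"
    obtain i where i: "doubling_chain a \<mu> (K \<mu>) i" using elim unfolding \<mu>_def by blast
    have Kpos: "K \<mu> > 0" and Kbig: "real (K \<mu>) / log 2 (a \<mu>) > \<theta>"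
      and a\<mu>: "a \<mu> \<ge> ln (real \<mu>) powr (1 / 2 + \<epsilon>)"
      and mon: "\<And>j. real j \<ge> r * real \<mu> \<Longrightarrow> a \<mu> \<le> s * a j" and aR: "a \<mu> > R" "a \<mu> > 1"
      and n1: "n \<ge> 1" and lnm: "ln (real n + 1) / 2 \<le> ln (real \<mu>)"
      using elim unfolding \<mu>_def by auto
    have "real \<mu> \<le> real n / (2 * r)" unfolding \<mu>_def m_def using r by simp
    then have r\<mu>: "2 * (r * real \<mu>) \<le> real n" using r by (simp add: field_simps)
    have \<mu>n: "2 * \<mu> \<le> n"
    proof -
      have "real \<mu> \<le> r * real \<mu>" using r by (simp add: mult_le_cancel_right1)
      then have "real (2 * \<mu>) \<le> real n" using r\<mu> by simp
      then show ?thesis by (simp only: of_nat_le_iff)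
    qed
    define J where "J = {n div 2<..n}"
    have J: "J \<subseteq> {\<mu><..n}" "J \<noteq> {}" using \<mu>n n1 unfolding J_def by auto
    have big: "a \<mu> / s \<le> a j" if "j \<in> J" for j
    proof -
      have "n \<le> 2 * j" using that unfolding J_def by auto
      then have "r * real \<mu> \<le> real j" using r\<mu> by linarith
      then show ?thesis using mon s by (simp add: divide_le_eq mult.commute)
    qed
    have p': "2 * (R + 2 * a \<mu>) < real p * (2 * (a \<mu> / s))"
    proof -
      have "s * (R + 2 * a \<mu>) \<le> s * (3 * a \<mu>)" using aR s by simp
      also have "\<dots> < real p * a \<mu>" using p aR by simp
      finally have "R + 2 * a \<mu> < real p * (a \<mu> / s)" using s by (simp add: divide_simps mult.commute)
      then have "2 * (R + 2 * a \<mu>) < 2 * (real p * (a \<mu> / s))"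
        by (rule mult_strict_left_mono) simp
      then show ?thesis by (subst mult.left_commute[of "real p"])
    qed
    have as: "a \<mu> / s > 0" using aR s by simp
    have conc: "real (card {U \<in> Pow {1..n}. \<bar>sign_sum a {1..n} U\<bar> \<le> R}) / 2 ^ n
      \<le> real q * real p / (2 ^ K \<mu> * sqrt (real (card J)))"
      using \<mu>n by (intro sign_sum_concentration[OF i Kpos _ c J as big q p']) auto
    have lnpos: "0 < ln (real n + 1)" using n1 by simp
    \<comment> \<open>The chain of estimates bounds \<open>(2 ^ K)^2\<close> from below through
      \<open>2 ^ K \<ge> a m powr \<theta>\<close> and the growth hypothesis at
      \<open>m\<close>.\<close>
    have "ln (real n + 1) powr (1 + \<epsilon>) / 2 powr (1 + \<epsilon>) = (ln (real n + 1) / 2) powr (1 + \<epsilon>)"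
      using lnpos by (simp add: powr_divide)
    also have "\<dots> \<le> ln (real \<mu>) powr (1 + \<epsilon>)"
      using lnm lnpos eps by (intro powr_mono2) auto
    also have "\<dots> = ((ln (real \<mu>) powr (1 / 2 + \<epsilon>)) powr \<theta>)\<^sup>2"
      unfolding \<theta>(3)[symmetric] powr_powr power2_eq_square powr_add[symmetric] by (simp only: mult_2)
    also have "\<dots> \<le> (a \<mu> powr \<theta>)\<^sup>2"
      using a\<mu> \<theta>(1) by (intro power_mono powr_mono2) auto
    also have "\<dots> \<le> (2 ^ K \<mu>)\<^sup>2"
    proof (intro power_mono)
      have "\<theta> * log 2 (a \<mu>) \<le> real (K \<mu>)" using Kbig aR(2) by (simp add: pos_less_divide_eq less_imp_le)
      then have "2 powr (\<theta> * log 2 (a \<mu>)) \<le> 2 powr real (K \<mu>)" by simp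
      moreover have "2 powr (\<theta> * log 2 (a \<mu>)) = a \<mu> powr \<theta>"
        using aR(2) by (metis less_trans mult.commute one_less_numeral_iff powr_log_cancel powr_powr
          semiring_norm(76) zero_less_numeral zero_less_one zero_neq_one less_irrefl)
      ultimately show "a \<mu> powr \<theta> \<le> 2 ^ K \<mu>" by (simp add: powr_realpow)
    qed simp
    finally have K2: "ln (real n + 1) powr (1 + \<epsilon>) / 2 powr (1 + \<epsilon>) \<le> (2 ^ K \<mu>)\<^sup>2" .
    have cardJ: "real n / 2 \<le> real (card J)" unfolding J_def by simp
    have "(real (card {U \<in> Pow {1..n}. \<bar>sign_sum a {1..n} U\<bar> \<le> R}) / 2 ^ n)\<^sup>2
      \<le> (real q * real p / (2 ^ K \<mu> * sqrt (real (card J))))\<^sup>2"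
      by (rule power_mono[OF conc]) simp
    also have "\<dots> = (real q * real p)\<^sup>2 / ((2 ^ K \<mu>)\<^sup>2 * real (card J))"
      by (simp add: power_divide power_mult_distrib)
    also have "\<dots> \<le> (real q * real p)\<^sup>2 / (ln (real n + 1) powr (1 + \<epsilon>) / 2 powr (1 + \<epsilon>) * (real n / 2))"
      using K2 cardJ lnpos n1 by (intro divide_left_mono mult_mono mult_pos_pos) (auto intro: order.strict_trans2)
    also have "\<dots> = D * (1 / (real n * ln (real n + 1) powr (1 + \<epsilon>)))"
      unfolding D_def by (simp add: field_simps)
    finally show ?case .
  qed
  then show ?thesis using that by blast
qed

section \<open>Borel-Cantelli and escape to infinity\<close>

theorem theorem2:
  fixes a :: "nat \<Rightarrow> real" and r s \<epsilon> :: real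
    and M :: "'w measure" and \<xi> :: "nat \<Rightarrow> 'w \<Rightarrow> real \<times> real"
  assumes "\<And>n. n \<ge> 1 \<Longrightarrow> a n > 0"
    and "good_seq a"
    and "r \<ge> 1" and "s \<ge> 1" and "rs_monotone r s a"
    and "\<epsilon> > 0"
    and "\<forall>\<^sub>F n in sequentially. a n \<ge> ln (real n) powr (1 / 2 + \<epsilon>)"
    and "prob_space M" and "iid_rademacher2 M \<xi>"
  shows "transient_walk M (walk2 a \<xi>)"
proof -
  interpret prob_space M by fact
  let ?A = "\<lambda>R n. {\<omega> \<in> space M. norm (walk2 a \<xi> n \<omega>) \<le> R}"
  have meas [measurable]: "walk2 a \<xi> n \<in> borel_measurable M" for n
    unfolding walk2_def using assms(9) unfolding iid_rademacher2_def rademacher2_def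
    by (intro borel_measurable_sum borel_measurable_scaleR) auto
  have "AE \<omega> in M. \<forall>\<^sub>F n in sequentially. \<omega> \<in> space M - ?A (real k) n" if "k > 0" for k :: nat
  proof (rule borel_cantelli_AE1)
    \<comment> \<open>The passage to signed sums doubles the radius.\<close>
    have R: "2 * real k > 0" using that by simp
    obtain D where D: "\<forall>\<^sub>F n in sequentially.
      (real (card {U \<in> Pow {1..n}. \<bar>sign_sum a {1..n} U\<bar> \<le> 2 * real k}) / 2 ^ n)\<^sup>2
        \<le> D * (1 / (real n * ln (real n + 1) powr (1 + \<epsilon>)))"
      using sign_sum_concentration_eventually[OF assms(1-7) R] by blast
    have "summable (\<lambda>n. D * (1 / (real n * ln (real n + 1) powr (1 + \<epsilon>))))"
      using assms(6) by (intro summable_mult summable_inverse_mult_ln_powr) simp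
    moreover have "\<forall>\<^sub>F n in sequentially. norm (prob (?A (real k) n))
        \<le> D * (1 / (real n * ln (real n + 1) powr (1 + \<epsilon>)))"
      using D
    proof eventually_elim
      case (elim n)
      then show ?case using prob_walk2_le[OF assms(9), of a n "real k"] by simp
    qed
    ultimately show "summable (\<lambda>n. prob (?A (real k) n))"
      by (rule summable_comparison_test_ev[rotated])
  qed (auto simp: less_top[symmetric])
  \<comment> \<open>Integer radii are countable, so a single null set serves for all of them, and
    they exceed every real bound.\<close>
  then have "AE \<omega> in M. \<forall>k::nat. k > 0 \<longrightarrow> (\<forall>\<^sub>F n in sequentially. \<omega> \<in> space M - ?A (real k) n)"
    by (simp add: AE_all_countable)
  then show ?thesis unfolding transient_walk_def
  proof eventually_elim
    case (elim \<omega>)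
    show ?case unfolding filterlim_at_top
    proof
      fix Z :: real
      obtain k' :: nat where "Z \<le> real k'" using real_arch_simple by blast
      then have k: "Z \<le> real (Suc k')" "Suc k' > 0" by auto
      have "\<forall>\<^sub>F n in sequentially. \<omega> \<in> space M - ?A (real (Suc k')) n" using elim k(2) by blast
      then show "\<forall>\<^sub>F n in sequentially. Z \<le> norm (walk2 a \<xi> n \<omega>)"
        by eventually_elim (use k in auto)
    qed
  qed
qed

end
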